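(* For unrelated machine scheduling with start-up costs (and hence for capacity constrained facility location), let $T^*$ be the makespan of an assignment of jobs to machines and $C^*$ the optimal start-up cost of an assignment with makespan $T^*$. No deterministic online algorithm can obtain a solution with makespan $o(m)T^*$ and start-up cost within a factor polylogarithmic in $m$, $n$ and $\rho$ of $C^*$, even if $T^*$ is available offline. This holds even for fractional solutions, in which jobs may be fractionally assigned to machines (each job's fractional assignments summing to at least $1$) and machines fractionally opened (each machine opened to at least the fractional assignment of any job to it).
   Context: UMSC: $m$ machines with start-up costs $c_i$ are known offline; $n$ jobs arrive online, job $j$ having processing time $p_{ij}$ on machine $i$. On arrival of a job the algorithm irrevocably starts machines (paying $c_i$) and assigns the job to a started machine. The makespan is the maximum over machines of the total processing time of jobs assigned to it. $\rho=\max_j\frac{\max_i(c_i+p_{ij})}{\min_i(c_i+p_{ij})}$. CCFL generalizes UMSC: facilities with fixed charges correspond to machines, clients to jobs, with zero assignment costs and congestion playing the role of makespan. *)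

theory Defs
  imports Complex_Main "HOL-Library.Landau_Symbols"
begin

section \<open>Instances\<close>

text \<open>
  An instance of unrelated machine scheduling with start-up costs is given by the list \<open>cs\<close> of
  start-up costs of the machines \<open>0, \<dots>, m - 1\<close>, where \<open>m = length cs\<close>, and the list \<open>ps\<close> of jobs
  in order of arrival, each job being the list of its processing times: \<open>p\<^sub>i\<^sub>j = ps ! j ! i\<close>.
  Strict positivity makes the ratio \<open>\<rho>\<close> well-defined and excludes degenerate instances such as
  those with optimal cost or makespan \<open>0\<close>; it only restricts the adversary.
\<close>

definition umsc_instance :: "real list \<Rightarrow> real list list \<Rightarrow> bool" where
  "umsc_instance cs ps \<longleftrightarrow>
     cs \<noteq> [] \<and> ps \<noteq> [] \<and> (\<forall>c\<in>set cs. 0 < c) \<and>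
     (\<forall>p\<in>set ps. length p = length cs \<and> (\<forall>t\<in>set p. 0 < t))"

text \<open>
  In capacity constrained facility location a client is a pair of its list of demands
  (which contribute to congestion) and its list of assignment costs, both indexed by facilities.
\<close>

definition ccfl_instance :: "real list \<Rightarrow> (real list \<times> real list) list \<Rightarrow> bool" where
  "ccfl_instance cs qs \<longleftrightarrow>
     umsc_instance cs (map fst qs) \<and>
     (\<forall>q\<in>set qs. length (snd q) = length cs \<and> (\<forall>a\<in>set (snd q). 0 \<le> a))"

text \<open>
  For facility location the ratio is that of the underlying scheduling instance; it does not
  involve the assignment costs.
\<close>

definition cost_ratio :: "real list \<Rightarrow> real list list \<Rightarrow> real" where
  "cost_ratio cs ps =
     (MAX j\<in>{..<length ps}. (MAX i\<in>{..<length cs}. cs ! i + ps ! j ! i) /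
                            (MIN i\<in>{..<length cs}. cs ! i + ps ! j ! i))"


section \<open>Integral solutions\<close>

text \<open>\<open>S\<close> is the set of started machines, and job \<open>j\<close> is assigned to machine \<open>\<sigma> j\<close>.\<close>

definition assignment :: "nat \<Rightarrow> nat \<Rightarrow> nat set \<Rightarrow> (nat \<Rightarrow> nat) \<Rightarrow> bool" where
  "assignment m n S \<sigma> \<longleftrightarrow> S \<subseteq> {..<m} \<and> (\<forall>j<n. \<sigma> j \<in> S)"

definition load :: "real list list \<Rightarrow> (nat \<Rightarrow> nat) \<Rightarrow> nat \<Rightarrow> real" where
  "load ps \<sigma> i = (\<Sum>j | j < length ps \<and> \<sigma> j = i. ps ! j ! i)"

definition makespan :: "nat \<Rightarrow> real list list \<Rightarrow> (nat \<Rightarrow> nat) \<Rightarrow> real" where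
  "makespan m ps \<sigma> = (MAX i\<in>{..<m}. load ps \<sigma> i)"

definition startup_cost :: "real list \<Rightarrow> nat set \<Rightarrow> real" where
  "startup_cost cs S = (\<Sum>i\<in>S. cs ! i)"

definition ccfl_cost ::
  "real list \<Rightarrow> (real list \<times> real list) list \<Rightarrow> nat set \<Rightarrow> (nat \<Rightarrow> nat) \<Rightarrow> real" where
  "ccfl_cost cs qs S \<sigma> = startup_cost cs S + (\<Sum>j<length qs. snd (qs ! j) ! \<sigma> j)"

definition is_makespan :: "nat \<Rightarrow> real list list \<Rightarrow> real \<Rightarrow> bool" where
  "is_makespan m ps T \<longleftrightarrow> (\<exists>S \<sigma>. assignment m (length ps) S \<sigma> \<and> makespan m ps \<sigma> = T)"

text \<open>
  The infima below are taken over finitely many values, hence attained if there is an assignment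
  of makespan \<open>T\<close>. Asking for makespan exactly \<open>T\<close> rather than at most \<open>T\<close> can only increase the
  optimal cost, and so only makes it easier for an algorithm to be competitive.
\<close>

definition umsc_opt :: "real list \<Rightarrow> real list list \<Rightarrow> real \<Rightarrow> real" where
  "umsc_opt cs ps T =
     Inf {startup_cost cs S | S \<sigma>.
            assignment (length cs) (length ps) S \<sigma> \<and> makespan (length cs) ps \<sigma> = T}"

definition ccfl_opt :: "real list \<Rightarrow> (real list \<times> real list) list \<Rightarrow> real \<Rightarrow> real" where
  "ccfl_opt cs qs T =
     Inf {ccfl_cost cs qs S \<sigma> | S \<sigma>.
            assignment (length cs) (length qs) S \<sigma> \<and> makespan (length cs) (map fst qs) \<sigma> = T}"


section \<open>Fractional solutions\<close>

text \<open>\<open>x i\<close> is the opening level of machine \<open>i\<close>; \<open>y j i\<close> is the fraction of job \<open>j\<close> on machine \<open>i\<close>.\<close>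

definition frac_makespan :: "nat \<Rightarrow> real list list \<Rightarrow> (nat \<Rightarrow> nat \<Rightarrow> real) \<Rightarrow> real" where
  "frac_makespan m ps y = (MAX i\<in>{..<m}. \<Sum>j<length ps. ps ! j ! i * y j i)"

definition frac_startup_cost :: "real list \<Rightarrow> (nat \<Rightarrow> real) \<Rightarrow> real" where
  "frac_startup_cost cs x = (\<Sum>i<length cs. cs ! i * x i)"

definition frac_ccfl_cost ::
  "real list \<Rightarrow> (real list \<times> real list) list \<Rightarrow> (nat \<Rightarrow> real) \<Rightarrow> (nat \<Rightarrow> nat \<Rightarrow> real) \<Rightarrow> real" where
  "frac_ccfl_cost cs qs x y =
     frac_startup_cost cs x + (\<Sum>j<length qs. \<Sum>i<length cs. snd (qs ! j) ! i * y j i)"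


section \<open>Deterministic online algorithms\<close>

text \<open>
  An algorithm knows the start-up costs (hence the number of machines) and \<open>T\<close> offline. On each
  arrival it sees the list of jobs that have arrived so far, the last one being the new job, and
  takes a decision. A decision is a pair: what is opened in addition to what was opened before,
  and where the new job goes. Earlier decisions therefore cannot be revoked.
\<close>

type_synonym ('job, 'dec) online_alg = "real list \<Rightarrow> real \<Rightarrow> 'job list \<Rightarrow> 'dec"

type_synonym 'job int_alg = "('job, nat set \<times> nat) online_alg"

type_synonym 'job frac_alg = "('job, (nat \<Rightarrow> real) \<times> (nat \<Rightarrow> real)) online_alg"

definition decision :: "('job, 'dec) online_alg \<Rightarrow> real list \<Rightarrow> real \<Rightarrow> 'job list \<Rightarrow> nat \<Rightarrow> 'dec" where
  "decision A cs T js j = A cs T (take (Suc j) js)"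

text \<open>The machines started during the first \<open>k\<close> arrivals.\<close>

definition started :: "'job int_alg \<Rightarrow> real list \<Rightarrow> real \<Rightarrow> 'job list \<Rightarrow> nat \<Rightarrow> nat set" where
  "started A cs T js k = (\<Union>j<k. fst (decision A cs T js j))"

definition assigned :: "'job int_alg \<Rightarrow> real list \<Rightarrow> real \<Rightarrow> 'job list \<Rightarrow> nat \<Rightarrow> nat" where
  "assigned A cs T js j = snd (decision A cs T js j)"

definition int_feasible :: "'job int_alg \<Rightarrow> real list \<Rightarrow> real \<Rightarrow> 'job list \<Rightarrow> bool" where
  "int_feasible A cs T js \<longleftrightarrow>
     (\<forall>j<length js. started A cs T js (Suc j) \<subseteq> {..<length cs} \<and>
                    assigned A cs T js j \<in> started A cs T js (Suc j))"

text \<open>The opening levels after the first \<open>k\<close> arrivals.\<close>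

definition opened :: "'job frac_alg \<Rightarrow> real list \<Rightarrow> real \<Rightarrow> 'job list \<Rightarrow> nat \<Rightarrow> nat \<Rightarrow> real" where
  "opened A cs T js k i = (\<Sum>j<k. fst (decision A cs T js j) i)"

definition frac_assigned :: "'job frac_alg \<Rightarrow> real list \<Rightarrow> real \<Rightarrow> 'job list \<Rightarrow> nat \<Rightarrow> nat \<Rightarrow> real" where
  "frac_assigned A cs T js j = snd (decision A cs T js j)"

definition frac_feasible :: "'job frac_alg \<Rightarrow> real list \<Rightarrow> real \<Rightarrow> 'job list \<Rightarrow> bool" where
  "frac_feasible A cs T js \<longleftrightarrow>
     (\<forall>j<length js.
        (\<forall>i<length cs. 0 \<le> fst (decision A cs T js j) i \<and>
                       0 \<le> frac_assigned A cs T js j i \<and>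
                       frac_assigned A cs T js j i \<le> opened A cs T js (Suc j) i) \<and>
        1 \<le> (\<Sum>i<length cs. frac_assigned A cs T js j i))"


section \<open>Competitiveness\<close>

text \<open>
  The makespan is within a factor \<open>g m\<close> of \<open>T\<close> and the cost within a factor \<open>f m n \<rho>\<close> of the
  optimal cost of an integral assignment with makespan \<open>T\<close>, for every achievable makespan \<open>T\<close>.
\<close>

definition umsc_competitive ::
  "real list int_alg \<Rightarrow> (nat \<Rightarrow> real) \<Rightarrow> (nat \<Rightarrow> nat \<Rightarrow> real \<Rightarrow> real) \<Rightarrow> bool" where
  "umsc_competitive A g f \<longleftrightarrow>
     (\<forall>cs ps T. umsc_instance cs ps \<and> is_makespan (length cs) ps T \<longrightarrow>
        int_feasible A cs T ps \<and>
        makespan (length cs) ps (assigned A cs T ps) \<le> g (length cs) * T \<and>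
        startup_cost cs (started A cs T ps (length ps))
          \<le> f (length cs) (length ps) (cost_ratio cs ps) * umsc_opt cs ps T)"

definition umsc_frac_competitive ::
  "real list frac_alg \<Rightarrow> (nat \<Rightarrow> real) \<Rightarrow> (nat \<Rightarrow> nat \<Rightarrow> real \<Rightarrow> real) \<Rightarrow> bool" where
  "umsc_frac_competitive A g f \<longleftrightarrow>
     (\<forall>cs ps T. umsc_instance cs ps \<and> is_makespan (length cs) ps T \<longrightarrow>
        frac_feasible A cs T ps \<and>
        frac_makespan (length cs) ps (frac_assigned A cs T ps) \<le> g (length cs) * T \<and>
        frac_startup_cost cs (opened A cs T ps (length ps))
          \<le> f (length cs) (length ps) (cost_ratio cs ps) * umsc_opt cs ps T)"

definition ccfl_competitive ::
  "(real list \<times> real list) int_alg \<Rightarrow> (nat \<Rightarrow> real) \<Rightarrow> (nat \<Rightarrow> nat \<Rightarrow> real \<Rightarrow> real) \<Rightarrow> bool" where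
  "ccfl_competitive A g f \<longleftrightarrow>
     (\<forall>cs qs T. ccfl_instance cs qs \<and> is_makespan (length cs) (map fst qs) T \<longrightarrow>
        int_feasible A cs T qs \<and>
        makespan (length cs) (map fst qs) (assigned A cs T qs) \<le> g (length cs) * T \<and>
        ccfl_cost cs qs (started A cs T qs (length qs)) (assigned A cs T qs)
          \<le> f (length cs) (length qs) (cost_ratio cs (map fst qs)) * ccfl_opt cs qs T)"

definition ccfl_frac_competitive ::
  "(real list \<times> real list) frac_alg \<Rightarrow> (nat \<Rightarrow> real) \<Rightarrow> (nat \<Rightarrow> nat \<Rightarrow> real \<Rightarrow> real) \<Rightarrow> bool" where
  "ccfl_frac_competitive A g f \<longleftrightarrow>
     (\<forall>cs qs T. ccfl_instance cs qs \<and> is_makespan (length cs) (map fst qs) T \<longrightarrow>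
        frac_feasible A cs T qs \<and>
        frac_makespan (length cs) (map fst qs) (frac_assigned A cs T qs) \<le> g (length cs) * T \<and>
        frac_ccfl_cost cs qs (opened A cs T qs (length qs)) (frac_assigned A cs T qs)
          \<le> f (length cs) (length qs) (cost_ratio cs (map fst qs)) * ccfl_opt cs qs T)"

text \<open>The summand \<open>1\<close> keeps the bound meaningful where all the logarithms vanish.\<close>

definition polylog :: "(nat \<Rightarrow> nat \<Rightarrow> real \<Rightarrow> real) \<Rightarrow> bool" where
  "polylog f \<longleftrightarrow>
     (\<exists>K d. \<forall>m n \<rho>. 1 \<le> m \<and> 1 \<le> n \<and> 1 \<le> \<rho> \<longrightarrow>
        f m n \<rho> \<le> K * (1 + ln (real m) + ln (real n) + ln \<rho>) ^ d)"

end

theory Submission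
  imports Defs "HOL-Real_Asymp.Real_Asymp"
begin

text \<open>
  With \<open>B = 2\<^sup>m\<close>, machine \<open>i < m\<close> has start-up cost \<open>B\<^sup>i\<close>, and job \<open>j < m - 1\<close> takes time \<open>1\<close> on
  machines \<open>0\<close> and \<open>j + 1\<close> and time \<open>B\<close> elsewhere. After \<open>k\<close> arrivals, putting the last job on machine
  \<open>0\<close> and every earlier job \<open>j\<close> on machine \<open>j + 1\<close> has makespan \<open>1\<close> and cost \<open>\<Sum>i<k. B\<^sup>i\<close>, which is far
  below the cost \<open>B\<^sup>k\<close> of the only alternative machine for the last job. Since \<open>ln \<rho>\<close> is only quadratic in
  \<open>m\<close>, a polylogarithmic cost factor is negligible against \<open>B\<close>, so a competitive algorithm has to put at
  least half of every job on machine \<open>0\<close>, whose load thus becomes linear in \<open>m\<close>.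
\<close>

section \<open>Reductions between the problems\<close>

definition int_to_frac :: "'job int_alg \<Rightarrow> 'job frac_alg" where
  "int_to_frac A cs T js =
     (\<lambda>i. of_bool (i \<in> fst (A cs T js) - started A cs T js (length js - 1)),
      \<lambda>i. of_bool (i = snd (A cs T js)))"

lemma decision_take:
  assumes "l < k"
  shows "decision A cs T (take k js) l = decision A cs T js l"
  using assms by (simp add: decision_def min_absorb1)

lemma started_take:
  assumes "l \<le> k"
  shows "started A cs T (take k js) l = started A cs T js l"
  using assms by (simp add: started_def decision_take)

text \<open>The algorithm is called on the jobs up to and including the new one, so
  \<open>length js - 1\<close> in \<open>int_to_frac\<close> is the index of the new job and counts
  the arrivals before it.\<close>

lemma decision_int_to_frac:
  assumes "j < length js"
  shows "decision (int_to_frac A) cs T js j =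
     (\<lambda>i. of_bool (i \<in> fst (decision A cs T js j) - started A cs T js j),
      \<lambda>i. of_bool (i = assigned A cs T js j))"
proof -
  have "length (take (Suc j) js) - 1 = j"
    using assms by simp
  then show ?thesis
    unfolding decision_def int_to_frac_def assigned_def
    by (simp add: started_take del: length_take)
qed

text \<open>Opening levels add up over the arrivals, so starting a machine twice would raise its
  level to 2. Subtracting the machines started earlier in \<open>int_to_frac\<close> makes each
  machine count once.\<close>

lemma opened_int_to_frac:
  assumes "k \<le> length js"
  shows "opened (int_to_frac A) cs T js k i = of_bool (i \<in> started A cs T js k)"
  using assms
proof (induction k)
  case 0
  then show ?case by (simp add: opened_def started_def)
next
  case (Suc k)
  have "opened (int_to_frac A) cs T js (Suc k) i =
        opened (int_to_frac A) cs T js k i + fst (decision (int_to_frac A) cs T js k) i"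
    by (simp add: opened_def)
  moreover have "started A cs T js (Suc k) = started A cs T js k \<union> fst (decision A cs T js k)"
    by (auto simp: started_def lessThan_Suc)
  ultimately show ?case
    using Suc by (auto simp: decision_int_to_frac)
qed

lemma frac_assigned_int_to_frac:
  assumes "j < length js"
  shows "frac_assigned (int_to_frac A) cs T js j i = of_bool (i = assigned A cs T js j)"
  using assms by (simp add: frac_assigned_def decision_int_to_frac)

lemma frac_feasible_int_to_frac:
  assumes "int_feasible A cs T js"
  shows "frac_feasible (int_to_frac A) cs T js"
proof -
  have "assigned A cs T js j \<in> started A cs T js (Suc j)" "assigned A cs T js j < length cs"
    if "j < length js" for j
    using assms that by (auto simp: int_feasible_def)
  then show ?thesis
    by (auto simp: frac_feasible_def decision_int_to_frac opened_int_to_frac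
        frac_assigned_int_to_frac Suc_le_eq sum.If_cases of_bool_def)
qed

lemma frac_makespan_int_to_frac:
  "frac_makespan m ps (frac_assigned (int_to_frac A) cs T ps) = makespan m ps (assigned A cs T ps)"
proof -
  have "(\<Sum>j<length ps. ps ! j ! i * frac_assigned (int_to_frac A) cs T ps j i) =
        load ps (assigned A cs T ps) i" for i
  proof -
    have "(\<Sum>j<length ps. ps ! j ! i * frac_assigned (int_to_frac A) cs T ps j i) =
          (\<Sum>j<length ps. if assigned A cs T ps j = i then ps ! j ! i else 0)"
      by (intro sum.cong) (auto simp: frac_assigned_int_to_frac)
    also have "\<dots> = load ps (assigned A cs T ps) i"
      unfolding load_def by (subst sum.inter_filter[symmetric]) auto
    finally show ?thesis .
  qed
  then show ?thesis
    by (simp add: frac_makespan_def makespan_def)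
qed

lemma frac_startup_cost_int_to_frac:
  assumes "int_feasible A cs T js"
  shows "frac_startup_cost cs (opened (int_to_frac A) cs T js (length js)) =
         startup_cost cs (started A cs T js (length js))"
proof -
  \<comment> \<open>The fractional cost only sees indices below \<open>length cs\<close>, whereas
    \<open>startup_cost\<close> sums over the whole set; feasibility rules out any
    difference.\<close>
  have "started A cs T js (length js) \<subseteq> {..<length cs}"
  proof
    fix i assume "i \<in> started A cs T js (length js)"
    then obtain j where j: "j < length js" "i \<in> fst (decision A cs T js j)"
      by (auto simp: started_def)
    then have "i \<in> started A cs T js (Suc j)"
      by (auto simp: started_def)
    then show "i \<in> {..<length cs}"
      using assms j(1) unfolding int_feasible_def by blast
  qed
  then have "{..<length cs} \<inter> started A cs T js (length js) = started A cs T js (length js)"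
    by blast
  then show ?thesis
    by (simp add: frac_startup_cost_def startup_cost_def opened_int_to_frac sum.If_cases
        of_bool_def if_distrib cong: if_cong)
qed

lemma umsc_frac_competitive_int_to_frac:
  assumes "umsc_competitive A g f"
  shows "umsc_frac_competitive (int_to_frac A) g f"
  using assms
  by (auto simp: umsc_competitive_def umsc_frac_competitive_def frac_feasible_int_to_frac
      frac_makespan_int_to_frac frac_startup_cost_int_to_frac)

section \<open>Scheduling as facility location with zero assignment costs\<close>

definition zero_assignment_costs :: "nat \<Rightarrow> real list \<Rightarrow> real list \<times> real list" where
  "zero_assignment_costs m p = (p, replicate m 0)"

text \<open>The decision type stays polymorphic so that one translation serves integral and
  fractional algorithms.\<close>

definition umsc_alg_of_ccfl ::
  "(real list \<times> real list, 'dec) online_alg \<Rightarrow> (real list, 'dec) online_alg" where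
  "umsc_alg_of_ccfl A cs T ps = A cs T (map (zero_assignment_costs (length cs)) ps)"

lemma fst_zero_assignment_costs [simp]: "fst (zero_assignment_costs m p) = p"
  and snd_zero_assignment_costs [simp]: "snd (zero_assignment_costs m p) = replicate m 0"
  by (simp_all add: zero_assignment_costs_def)

lemma map_fst_zero_assignment_costs [simp]: "map fst (map (zero_assignment_costs m) ps) = ps"
  by (simp add: comp_def)

lemma decision_umsc_alg_of_ccfl:
  "decision (umsc_alg_of_ccfl A) cs T ps =
   decision A cs T (map (zero_assignment_costs (length cs)) ps)"
  by (simp add: decision_def umsc_alg_of_ccfl_def take_map fun_eq_iff)

lemma ccfl_instance_zero_assignment_costs:
  assumes "umsc_instance cs ps"
  shows "ccfl_instance cs (map (zero_assignment_costs (length cs)) ps)"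
  unfolding ccfl_instance_def map_fst_zero_assignment_costs using assms by auto

text \<open>The bound on \<sigma> keeps the lookup inside the list of zeros; beyond its end the
  value is unspecified.\<close>

lemma ccfl_cost_zero_assignment_costs:
  assumes "\<And>j. j < length ps \<Longrightarrow> \<sigma> j < length cs"
  shows "ccfl_cost cs (map (zero_assignment_costs (length cs)) ps) S \<sigma> = startup_cost cs S"
  using assms by (simp add: ccfl_cost_def)

lemma frac_ccfl_cost_zero_assignment_costs:
  "frac_ccfl_cost cs (map (zero_assignment_costs (length cs)) ps) x y = frac_startup_cost cs x"
  by (simp add: frac_ccfl_cost_def)

text \<open>Assignments use existing machines only, so both infima range over the same set of
  costs.\<close>

lemma ccfl_opt_zero_assignment_costs:
  "ccfl_opt cs (map (zero_assignment_costs (length cs)) ps) T = umsc_opt cs ps T"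
proof -
  have "ccfl_cost cs (map (zero_assignment_costs (length cs)) ps) S \<sigma> = startup_cost cs S"
    if "assignment (length cs) (length ps) S \<sigma>" for S \<sigma>
    using that by (intro ccfl_cost_zero_assignment_costs) (auto simp: assignment_def)
  then have "{ccfl_cost cs (map (zero_assignment_costs (length cs)) ps) S \<sigma> | S \<sigma>.
      assignment (length cs) (length ps) S \<sigma> \<and> makespan (length cs) ps \<sigma> = T} =
    {startup_cost cs S | S \<sigma>.
      assignment (length cs) (length ps) S \<sigma> \<and> makespan (length cs) ps \<sigma> = T}"
    by (intro Collect_cong) metis
  then show ?thesis
    unfolding ccfl_opt_def umsc_opt_def map_fst_zero_assignment_costs length_map by simp
qed

lemma umsc_competitive_umsc_alg_of_ccfl:
  assumes "ccfl_competitive A g f"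
  shows "umsc_competitive (umsc_alg_of_ccfl A) g f"
  unfolding umsc_competitive_def
proof (intro allI impI)
  fix cs ps T
  assume inst: "umsc_instance cs ps \<and> is_makespan (length cs) ps T"
  define qs where "qs = map (zero_assignment_costs (length cs)) ps"
  have fst_qs: "map fst qs = ps"
    unfolding qs_def by (rule map_fst_zero_assignment_costs)
  have len: "length qs = length ps"
    by (simp add: qs_def)
  have "ccfl_instance cs qs \<and> is_makespan (length cs) (map fst qs) T"
    using inst unfolding fst_qs by (simp add: qs_def ccfl_instance_zero_assignment_costs)
  then have comp: "int_feasible A cs T qs"
    "makespan (length cs) ps (assigned A cs T qs) \<le> g (length cs) * T"
    "ccfl_cost cs qs (started A cs T qs (length ps)) (assigned A cs T qs)
       \<le> f (length cs) (length ps) (cost_ratio cs ps) * umsc_opt cs ps T"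
    using assms unfolding ccfl_competitive_def
    by (metis fst_qs, metis fst_qs, metis fst_qs len qs_def ccfl_opt_zero_assignment_costs)
  \<comment> \<open>Feasibility has to come first: it puts the assigned machines in the range where
    assignment costs vanish.\<close>
  have "assigned A cs T qs j < length cs" if "j < length ps" for j
    using comp(1) that len by (auto simp: int_feasible_def)
  then have "ccfl_cost cs qs (started A cs T qs (length ps)) (assigned A cs T qs) =
             startup_cost cs (started A cs T qs (length ps))"
    unfolding qs_def by (rule ccfl_cost_zero_assignment_costs)
  moreover have "started (umsc_alg_of_ccfl A) cs T ps = started A cs T qs"
    "assigned (umsc_alg_of_ccfl A) cs T ps = assigned A cs T qs"
    by (simp_all add: fun_eq_iff started_def assigned_def decision_umsc_alg_of_ccfl qs_def)
  ultimately show "int_feasible (umsc_alg_of_ccfl A) cs T ps \<and>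
        makespan (length cs) ps (assigned (umsc_alg_of_ccfl A) cs T ps) \<le> g (length cs) * T \<and>
        startup_cost cs (started (umsc_alg_of_ccfl A) cs T ps (length ps))
          \<le> f (length cs) (length ps) (cost_ratio cs ps) * umsc_opt cs ps T"
    using comp len by (simp add: int_feasible_def)
qed

lemma umsc_frac_competitive_umsc_alg_of_ccfl:
  assumes "ccfl_frac_competitive A g f"
  shows "umsc_frac_competitive (umsc_alg_of_ccfl A) g f"
  unfolding umsc_frac_competitive_def
proof (intro allI impI)
  fix cs ps T
  assume inst: "umsc_instance cs ps \<and> is_makespan (length cs) ps T"
  define qs where "qs = map (zero_assignment_costs (length cs)) ps"
  have fst_qs: "map fst qs = ps"
    unfolding qs_def by (rule map_fst_zero_assignment_costs)
  have len: "length qs = length ps"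
    by (simp add: qs_def)
  have "ccfl_instance cs qs \<and> is_makespan (length cs) (map fst qs) T"
    using inst unfolding fst_qs by (simp add: qs_def ccfl_instance_zero_assignment_costs)
  then have comp: "frac_feasible A cs T qs"
    "frac_makespan (length cs) ps (frac_assigned A cs T qs) \<le> g (length cs) * T"
    "frac_startup_cost cs (opened A cs T qs (length ps))
       \<le> f (length cs) (length ps) (cost_ratio cs ps) * umsc_opt cs ps T"
    using assms unfolding ccfl_frac_competitive_def
    by (metis fst_qs, metis fst_qs,
        metis fst_qs len qs_def ccfl_opt_zero_assignment_costs frac_ccfl_cost_zero_assignment_costs)
  moreover have "opened (umsc_alg_of_ccfl A) cs T ps = opened A cs T qs"
    "frac_assigned (umsc_alg_of_ccfl A) cs T ps = frac_assigned A cs T qs"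
    by (simp_all add: fun_eq_iff opened_def frac_assigned_def decision_umsc_alg_of_ccfl qs_def)
  ultimately show "frac_feasible (umsc_alg_of_ccfl A) cs T ps \<and>
        frac_makespan (length cs) ps (frac_assigned (umsc_alg_of_ccfl A) cs T ps)
          \<le> g (length cs) * T \<and>
        frac_startup_cost cs (opened (umsc_alg_of_ccfl A) cs T ps (length ps))
          \<le> f (length cs) (length ps) (cost_ratio cs ps) * umsc_opt cs ps T"
    using len by (simp add: frac_feasible_def decision_umsc_alg_of_ccfl flip: qs_def)
qed


section \<open>The hard instances\<close>

text \<open>A single job suffices, the ratio being a maximum over jobs. The bound is needed because
  \<open>polylog\<close> restricts \<open>f\<close> only for ratios of at least 1.\<close>

lemma cost_ratio_ge_1:
  assumes "umsc_instance cs ps"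
  shows "1 \<le> cost_ratio cs ps"
proof -
  let ?s = "\<lambda>j i. cs ! i + ps ! j ! i"
  let ?ratio = "\<lambda>j. (MAX i\<in>{..<length cs}. ?s j i) / (MIN i\<in>{..<length cs}. ?s j i)"
  have m: "0 < length cs" and n: "0 < length ps"
    using assms by (auto simp: umsc_instance_def)
  have pos: "0 < ?s 0 i" if "i < length cs" for i
  proof -
    have "ps ! 0 \<in> set ps" "cs ! i \<in> set cs"
      using that n by simp_all
    then show ?thesis
      using assms that unfolding umsc_instance_def by (metis add_pos_pos nth_mem)
  qed
  have "0 < (MIN i\<in>{..<length cs}. ?s 0 i)"
    using m pos by (subst Min_gr_iff) auto
  moreover have "(MIN i\<in>{..<length cs}. ?s 0 i) \<le> ?s 0 0" "?s 0 0 \<le> (MAX i\<in>{..<length cs}. ?s 0 i)"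
    using m by (auto intro!: Min_le Max_ge)
  ultimately have "1 \<le> ?ratio 0"
    by (simp add: field_simps)
  also have "\<dots> \<le> cost_ratio cs ps"
    unfolding cost_ratio_def using n by (intro Max_ge) auto
  finally show ?thesis .
qed

section \<open>Bounds on the optimal start-up cost\<close>

lemma startup_cost_nonneg:
  assumes "umsc_instance cs ps" "assignment (length cs) n S \<sigma>"
  shows "0 \<le> startup_cost cs S"
  unfolding startup_cost_def
proof (rule sum_nonneg)
  fix i assume "i \<in> S"
  then have "cs ! i \<in> set cs"
    using assms(2) by (auto simp: assignment_def)
  then show "0 \<le> cs ! i"
    using assms(1) by (simp add: umsc_instance_def less_imp_le)
qed

text \<open>Achievability of \<open>T\<close> makes the set of costs nonempty, so that its infimum
  is meaningful. The sign is later used to multiply a bound on \<open>f\<close> by the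
  optimum.\<close>

lemma umsc_opt_nonneg:
  assumes "umsc_instance cs ps" "is_makespan (length cs) ps T"
  shows "0 \<le> umsc_opt cs ps T"
  unfolding umsc_opt_def
proof (rule cInf_greatest)
  show "{startup_cost cs S | S \<sigma>.
          assignment (length cs) (length ps) S \<sigma> \<and> makespan (length cs) ps \<sigma> = T} \<noteq> {}"
    using assms(2) unfolding is_makespan_def by blast
qed (use startup_cost_nonneg[OF assms(1)] in blast)

lemma umsc_opt_le:
  assumes "umsc_instance cs ps" "assignment (length cs) (length ps) S \<sigma>"
    "makespan (length cs) ps \<sigma> = T"
  shows "umsc_opt cs ps T \<le> startup_cost cs S"
  unfolding umsc_opt_def
proof (rule cInf_lower)
  show "bdd_below {startup_cost cs S | S \<sigma>.
          assignment (length cs) (length ps) S \<sigma> \<and> makespan (length cs) ps \<sigma> = T}"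
    using startup_cost_nonneg[OF assms(1)] by (intro bdd_belowI[of _ 0]) blast
qed (use assms in blast)

section \<open>The family of hard instances\<close>

definition hard_costs :: "nat \<Rightarrow> real list" where
  "hard_costs m = map (\<lambda>i. (2 ^ m) ^ i) [0..<m]"

text \<open>Machine 0 is fast for all jobs, machine \<open>Suc j\<close> for job \<open>j\<close>
  alone. The latter exists only if \<open>j < m - 1\<close>, which limits the sequences considered
  to \<open>m - 1\<close> jobs.\<close>

definition hard_job :: "nat \<Rightarrow> nat \<Rightarrow> real list" where
  "hard_job m j = map (\<lambda>i. if i = 0 \<or> i = Suc j then 1 else 2 ^ m) [0..<m]"

definition hard_jobs :: "nat \<Rightarrow> nat \<Rightarrow> real list list" where
  "hard_jobs m k = map (hard_job m) [0..<k]"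

lemma length_hard_costs [simp]: "length (hard_costs m) = m"
  and length_hard_jobs [simp]: "length (hard_jobs m k) = k"
  by (simp_all add: hard_costs_def hard_jobs_def)

lemma nth_hard_costs: "i < m \<Longrightarrow> hard_costs m ! i = (2 ^ m) ^ i"
  by (simp add: hard_costs_def)

lemma nth_hard_jobs:
  "j < k \<Longrightarrow> i < m \<Longrightarrow> hard_jobs m k ! j ! i = (if i = 0 \<or> i = Suc j then 1 else 2 ^ m)"
  by (simp add: hard_jobs_def hard_job_def)

lemma take_hard_jobs: "l \<le> k \<Longrightarrow> take l (hard_jobs m k) = hard_jobs m l"
  by (simp add: hard_jobs_def take_map)

text \<open>An online algorithm cannot tell where the sequence will stop, so the guarantees for all
  stopping times \<open>k\<close> constrain one and the same run.\<close>

lemma decision_hard_jobs: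
  "j < k \<Longrightarrow> k \<le> n \<Longrightarrow> decision A cs T (hard_jobs m k) j = decision A cs T (hard_jobs m n) j"
  using decision_take[of j k A cs T "hard_jobs m n"] by (simp add: take_hard_jobs)

lemma umsc_instance_hard:
  assumes "0 < m" "0 < k"
  shows "umsc_instance (hard_costs m) (hard_jobs m k)"
  using assms by (auto simp: umsc_instance_def hard_costs_def hard_jobs_def hard_job_def)

text \<open>With \<open>B = 2 ^ m\<close>, each sum of start-up cost and processing time lies
  between 1 and \<open>2 * B ^ m\<close>, and \<open>2 \<le> B\<close> absorbs the factor 2.\<close>

lemma cost_ratio_hard_le:
  assumes "0 < m" "0 < k"
  shows "cost_ratio (hard_costs m) (hard_jobs m k) \<le> (2 ^ m) ^ Suc m"
proof -
  let ?s = "\<lambda>j i. hard_costs m ! i + hard_jobs m k ! j ! i"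
  have B: "2 \<le> (2::real) ^ m"
    using power_increasing[of 1 m "2::real"] assms(1) by simp
  have "(MAX i\<in>{..<m}. ?s j i) / (MIN i\<in>{..<m}. ?s j i) \<le> (2 ^ m) ^ Suc m" if j: "j < k" for j
  proof -
    have s: "1 \<le> ?s j i \<and> ?s j i \<le> 2 * (2 ^ m) ^ m" if i: "i < m" for i
    proof -
      have "1 \<le> ((2::real) ^ m) ^ i" "((2::real) ^ m) ^ i \<le> (2 ^ m) ^ m"
        using i B by (auto intro!: one_le_power power_increasing)
      moreover have "(2::real) ^ m \<le> (2 ^ m) ^ m"
        using power_increasing[of 1 m "(2::real) ^ m"] B assms(1) by simp
      moreover have "0 \<le> hard_jobs m k ! j ! i" "hard_jobs m k ! j ! i \<le> 2 ^ m"
        using B i j by (simp_all add: nth_hard_jobs)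
      ultimately show ?thesis
        unfolding nth_hard_costs[OF i] by linarith
    qed
    have mx: "(MAX i\<in>{..<m}. ?s j i) \<le> 2 * (2 ^ m) ^ m"
      using s assms(1) by (subst Max_le_iff) auto
    have mn: "1 \<le> (MIN i\<in>{..<m}. ?s j i)"
      using s assms(1) by (subst Min_ge_iff) auto
    have "(MAX i\<in>{..<m}. ?s j i) / (MIN i\<in>{..<m}. ?s j i) \<le> (2 * (2 ^ m) ^ m) / 1"
      using mx mn by (intro frac_le) auto
    also have "\<dots> \<le> (2 ^ m) ^ Suc m"
      using B by (simp add: mult_right_mono)
    finally show ?thesis .
  qed
  then show ?thesis
    unfolding cost_ratio_def length_hard_costs length_hard_jobs
    using assms by (subst Max_le_iff) auto
qed

lemma hard_assignment:
  assumes "0 < k" "k < m"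
  obtains \<sigma> where "assignment m k {..<k} \<sigma>" "makespan m (hard_jobs m k) \<sigma> = 1"
proof
  define \<sigma> where "\<sigma> j = (if Suc j = k then 0 else Suc j)" for j
  show "assignment m k {..<k} \<sigma>"
    using assms by (auto simp: assignment_def \<sigma>_def)
  \<comment> \<open>Every job runs on a machine where it takes time 1, so loads are counts.\<close>
  have load: "load (hard_jobs m k) \<sigma> i = card {j. j < k \<and> \<sigma> j = i}" if "i < m" for i
  proof -
    have "load (hard_jobs m k) \<sigma> i = (\<Sum>j | j < k \<and> \<sigma> j = i. 1)"
      unfolding load_def length_hard_jobs using that
      by (intro sum.cong) (auto simp: nth_hard_jobs \<sigma>_def split: if_splits)
    then show ?thesis by simp
  qed
  \<comment> \<open>\<sigma> is injective on the \<open>k\<close> jobs.\<close>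
  have "card {j. j < k \<and> \<sigma> j = i} \<le> 1" for i
    by (intro card_le_Suc0_iff_eq[THEN iffD2, simplified One_nat_def[symmetric]])
       (auto simp: \<sigma>_def split: if_splits)
  \<comment> \<open>The makespan must be exactly 1; machine 0 attains it.\<close>
  moreover have "{j. j < k \<and> \<sigma> j = 0} = {k - 1}"
    using assms by (auto simp: \<sigma>_def)
  ultimately show "makespan m (hard_jobs m k) \<sigma> = 1"
    unfolding makespan_def using assms load by (intro Max_eqI) (auto intro!: image_eqI[of _ _ 0])
qed

lemma is_makespan_hard:
  assumes "0 < k" "k < m"
  shows "is_makespan m (hard_jobs m k) 1"
  using hard_assignment[OF assms] unfolding is_makespan_def by (metis length_hard_jobs)

text \<open>The geometric sum is bounded crudely by the number of its terms times the largest; the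
  resulting factor \<open>m\<close> is harmless next to \<open>2 ^ m\<close>.\<close>

lemma umsc_opt_hard_le:
  assumes "0 < k" "k < m"
  shows "umsc_opt (hard_costs m) (hard_jobs m k) 1 \<le> real m * (2 ^ m) ^ (k - 1)"
proof -
  obtain \<sigma> where "assignment m k {..<k} \<sigma>" "makespan m (hard_jobs m k) \<sigma> = 1"
    using hard_assignment[OF assms] .
  then have "umsc_opt (hard_costs m) (hard_jobs m k) 1 \<le> startup_cost (hard_costs m) {..<k}"
    using assms by (intro umsc_opt_le umsc_instance_hard) auto
  also have "\<dots> = (\<Sum>i<k. (2 ^ m) ^ i)"
    unfolding startup_cost_def using assms by (intro sum.cong) (auto simp: nth_hard_costs)
  also have "\<dots> \<le> (\<Sum>i<k. (2 ^ m) ^ (k - 1))"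
    using assms by (intro sum_mono power_increasing) auto
  also have "\<dots> \<le> real m * (2 ^ m) ^ (k - 1)"
    using assms by (simp add: mult_right_mono)
  finally show ?thesis .
qed

text \<open>Each condition holds for all large \<open>m\<close>: the one on \<open>g\<close> by the
  little-o assumption, the others by exponential against polynomial growth. The polynomial in the
  last one dominates the argument of the polylogarithm, using that \<open>ln \<rho>\<close> is at
  most \<open>(m + 1) * m\<close> on the hard instances.\<close>

lemma hard_size_exists:
  fixes g :: "nat \<Rightarrow> real" and K :: real
  assumes "g \<in> o(\<lambda>m. real m)"
  obtains m :: nat where "3 \<le> m" "g m \<le> m / 4" "real m ^ 2 \<le> 2 ^ m"
    "K * (1 + real m + real m + (real m + 1) * real m) ^ d * m \<le> 2 ^ m / 4"
proof -
  have "eventually (\<lambda>m. norm (g m) \<le> 1 / 4 * norm (real m)) sequentially"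
    using landau_o.smallD[OF assms, of "1 / 4"] by simp
  moreover have "eventually (\<lambda>m::nat. real m ^ 2 \<le> 2 ^ m) sequentially"
    by real_asymp
  moreover have "(\<lambda>m::nat. K * (1 + real m + real m + (real m + 1) * real m) ^ d * m / 2 ^ m)
      \<longlonglongrightarrow> 0"
    by real_asymp
  then have "eventually (\<lambda>m::nat. K * (1 + real m + real m + (real m + 1) * real m) ^ d * m / 2 ^ m
      < 1 / 4) sequentially"
    by (rule order_tendstoD) simp
  ultimately have "eventually (\<lambda>m. 3 \<le> m \<and> norm (g m) \<le> 1 / 4 * norm (real m) \<and>
      real m ^ 2 \<le> 2 ^ m \<and>
      K * (1 + real m + real m + (real m + 1) * real m) ^ d * m / 2 ^ m < 1 / 4) sequentially"
    using eventually_ge_at_top[of 3] by eventually_elim simp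
  from eventually_happens'[OF sequentially_bot this]
  obtain m where "3 \<le> m" "norm (g m) \<le> 1 / 4 * norm (real m)" "real m ^ 2 \<le> 2 ^ m"
    "K * (1 + real m + real m + (real m + 1) * real m) ^ d * m / 2 ^ m < 1 / 4"
    by blast
  then show ?thesis
    by (intro that) (auto simp: field_simps)
qed

section \<open>The lower bound for fractional scheduling\<close>

lemma not_umsc_frac_competitive:
  assumes "g \<in> o(\<lambda>m. real m)" and "polylog f"
  shows "\<not> umsc_frac_competitive A g f"
proof
  assume comp: "umsc_frac_competitive A g f"
  from \<open>polylog f\<close> obtain K' d where polylog: "\<And>m n \<rho>. 1 \<le> m \<Longrightarrow> 1 \<le> n \<Longrightarrow> 1 \<le> \<rho> \<Longrightarrow>
      f m n \<rho> \<le> K' * (1 + ln (real m) + ln (real n) + ln \<rho>) ^ d"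
    unfolding polylog_def by blast
  \<comment> \<open>The constant in \<open>polylog\<close> may be negative; a nonnegative one allows
    the logarithms to be replaced by upper bounds.\<close>
  define K where "K = \<bar>K'\<bar>"
  obtain m :: nat where m: "3 \<le> m" and g: "g m \<le> m / 4" and B: "real m ^ 2 \<le> 2 ^ m"
    and Km: "K * (1 + real m + real m + (real m + 1) * real m) ^ d * m \<le> 2 ^ m / 4"
    using hard_size_exists[OF assms(1)] .
  define F where "F = K * (1 + real m + real m + (real m + 1) * real m) ^ d"
  define cs where "cs = hard_costs m"
  define js where "js = hard_jobs m (m - 1)"
  define y where "y = frac_assigned A cs 1 js"
  define x where "x = opened A cs 1 js"
  have "0 \<le> F"
    by (simp add: F_def K_def)

  \<comment> \<open>The value \<open>T = 1\<close> is achievable for every \<open>k\<close>, so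
    knowing it offline reveals nothing about the stopping time.\<close>
  have prefix: "frac_feasible A cs 1 (hard_jobs m k) \<and>
      frac_makespan m (hard_jobs m k) (frac_assigned A cs 1 (hard_jobs m k)) \<le> g m \<and>
      frac_startup_cost cs (opened A cs 1 (hard_jobs m k) k) \<le>
        f m k (cost_ratio cs (hard_jobs m k)) * umsc_opt cs (hard_jobs m k) 1"
    if "0 < k" "k < m" for k
    using comp[unfolded umsc_frac_competitive_def, rule_format, of cs "hard_jobs m k" 1]
      umsc_instance_hard[of m k] is_makespan_hard[of k m] that
    by (simp add: cs_def)
  have feasible: "frac_feasible A cs 1 js"
    and makespan: "frac_makespan m js y \<le> g m"
    using prefix[of "m - 1"] m by (simp_all add: js_def y_def)
  have y_nonneg: "0 \<le> y j i" and y_le: "y j i \<le> x (Suc j) i" if "j < m - 1" "i < m" for j i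
    using feasible that by (simp_all add: frac_feasible_def js_def cs_def y_def x_def)
  have y_sum: "1 \<le> (\<Sum>i<m. y j i)" if "j < m - 1" for j
    using feasible that by (simp add: frac_feasible_def js_def cs_def y_def)
  have x_nonneg: "0 \<le> x k i" if "k \<le> m - 1" "i < m" for k i
    using feasible that
    by (auto simp: frac_feasible_def js_def cs_def x_def opened_def intro!: sum_nonneg)

  \<comment> \<open>The levels reached in the long run after \<open>k\<close> arrivals are charged
    against the optimum of the prefix of length \<open>k\<close>.\<close>
  have cost: "(\<Sum>i<m. (2 ^ m) ^ i * x k i) \<le> F * (real m * (2 ^ m) ^ (k - 1))" if k: "0 < k" "k < m" for k
  proof -
    let ?\<rho> = "cost_ratio cs (hard_jobs m k)"
    have inst: "umsc_instance cs (hard_jobs m k)"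
      using m k by (simp add: cs_def umsc_instance_hard)
    have \<rho>: "1 \<le> ?\<rho>" "?\<rho> \<le> (2 ^ m) ^ Suc m"
      using m k cost_ratio_ge_1[OF inst] cost_ratio_hard_le[of m k] by (simp_all add: cs_def)
    have "ln ?\<rho> \<le> ln ((2 ^ m) ^ Suc m)"
      using \<rho> by (subst ln_le_cancel_iff) auto
    also have "\<dots> = (real m + 1) * (real m * ln 2)"
      by (simp add: ln_realpow ln_mult algebra_simps)
    also have "\<dots> \<le> (real m + 1) * (real m * 1)"
      using ln_less_self[of "2::real"] ln_le_minus_one[of "2::real"]
      by (intro mult_left_mono) auto
    finally have "ln ?\<rho> \<le> (real m + 1) * real m" by simp
    moreover have "ln (real m) \<le> m" "ln (real k) \<le> m"
      using ln_less_self[of "real m"] ln_less_self[of "real k"] m k by linarith+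
    moreover have "0 \<le> ln (real m)" "0 \<le> ln (real k)" "0 \<le> ln ?\<rho>"
      using m k \<rho> by auto
    ultimately have "(1 + ln (real m) + ln (real k) + ln ?\<rho>) ^ d \<le>
        (1 + real m + real m + (real m + 1) * real m) ^ d"
      by (intro power_mono) linarith+
    moreover have "f m k ?\<rho> \<le> K' * (1 + ln (real m) + ln (real k) + ln ?\<rho>) ^ d"
      using m k \<rho> by (intro polylog) auto
    moreover have "\<dots> \<le> K * (1 + ln (real m) + ln (real k) + ln ?\<rho>) ^ d"
      using \<open>0 \<le> ln (real m)\<close> \<open>0 \<le> ln (real k)\<close> \<open>0 \<le> ln ?\<rho>\<close>
      by (intro mult_right_mono zero_le_power) (auto simp: K_def)
    ultimately have "f m k ?\<rho> \<le> F"
      unfolding F_def by (smt (verit) K_def abs_ge_zero mult_left_mono)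
    moreover have "0 \<le> umsc_opt cs (hard_jobs m k) 1"
      using inst k is_makespan_hard[of k m] by (intro umsc_opt_nonneg) (auto simp: cs_def)
    ultimately have "f m k ?\<rho> * umsc_opt cs (hard_jobs m k) 1 \<le> F * (real m * (2 ^ m) ^ (k - 1))"
      using umsc_opt_hard_le[OF k] \<open>0 \<le> F\<close> unfolding cs_def
      by (meson mult_left_mono mult_right_mono order_trans)
    moreover have "frac_startup_cost cs (opened A cs 1 (hard_jobs m k) k) =
        (\<Sum>i<m. (2 ^ m) ^ i * x k i)"
      using k decision_hard_jobs[of _ k "m - 1" A cs 1 m]
      by (simp add: frac_startup_cost_def opened_def x_def js_def cs_def nth_hard_costs)
    ultimately show ?thesis
      using prefix[OF k] by simp
  qed

  \<comment> \<open>If the sequence stopped right after job \<open>j\<close>, the budget would be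
    \<open>F * m * B ^ j\<close> with \<open>B = 2 ^ m\<close>, while fully opening machine
    \<open>Suc j\<close> costs \<open>B ^ Suc j\<close>; the choice of \<open>m\<close> gives
    \<open>F * m \<le> B / 4\<close>.\<close>
  have y_next: "y j (Suc j) \<le> 1 / 4" if j: "j < m - 1" for j
  proof -
    have "(2 ^ m) ^ Suc j * y j (Suc j) \<le> (2 ^ m) ^ Suc j * x (Suc j) (Suc j)"
      using y_le[of j "Suc j"] j by (intro mult_left_mono) auto
    also have "\<dots> \<le> (\<Sum>i<m. (2 ^ m) ^ i * x (Suc j) i)"
      using j x_nonneg[of "Suc j"] by (intro member_le_sum) auto
    also have "\<dots> \<le> F * m * (2 ^ m) ^ j"
      using cost[of "Suc j"] j by (simp add: mult.assoc less_diff_conv)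
    also have "\<dots> \<le> 2 ^ m / 4 * (2 ^ m) ^ j"
      using Km by (intro mult_right_mono) (auto simp: F_def)
    also have "\<dots> = (2 ^ m) ^ Suc j * (1 / 4)"
      by simp
    finally show ?thesis
      by (subst (asm) mult_le_cancel_left_pos) auto
  qed

  have load: "(\<Sum>j<m - 1. js ! j ! i * y j i) \<le> m / 4" if "i < m" for i
  proof -
    have "(\<Sum>j<m - 1. js ! j ! i * y j i) \<le> frac_makespan m js y"
      unfolding frac_makespan_def using that by (intro Max_ge) (auto simp: js_def)
    then show ?thesis
      using makespan g by linarith
  qed

  \<comment> \<open>Here the makespan is the obstacle, as the job takes time \<open>2 ^ m\<close>,
    at least \<open>m ^ 2\<close>. One factor \<open>m\<close> cancels against the load bound
    \<open>m / 4\<close>, the other pays for summing over up to \<open>m\<close> machines.\<close>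
  have y_other: "y j i \<le> 1 / (4 * m)" if j: "j < m - 1" and i: "i < m" "i \<noteq> 0" "i \<noteq> Suc j" for i j
  proof -
    have "2 ^ m * y j i = js ! j ! i * y j i"
      using i j by (simp add: js_def nth_hard_jobs)
    also have "\<dots> \<le> (\<Sum>j<m - 1. js ! j ! i * y j i)"
      using i j y_nonneg by (intro member_le_sum[of j _ "\<lambda>j. js ! j ! i * y j i"])
        (auto simp: js_def nth_hard_jobs)
    also have "\<dots> \<le> m / 4"
      using load i by blast
    finally have "2 ^ m * y j i \<le> m / 4" .
    moreover have "real m ^ 2 * y j i \<le> 2 ^ m * y j i"
      using B y_nonneg i j by (intro mult_right_mono) auto
    ultimately have "real m * (real m * y j i) \<le> real m * (1 / 4)"
      by (simp add: power2_eq_square)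
    then show ?thesis
      using m by (subst (asm) mult_le_cancel_left_pos) (auto simp: field_simps)
  qed

  \<comment> \<open>Machine \<open>Suc j\<close> takes at most a quarter of the job, and so do all
    slow machines together.\<close>
  have "1 / 2 \<le> y j 0" if j: "j < m - 1" for j
  proof -
    have "1 \<le> (\<Sum>i<m. y j i)"
      using y_sum j .
    also have "\<dots> = y j 0 + y j (Suc j) + (\<Sum>i\<in>{..<m} - {0} - {Suc j}. y j i)"
      using j m by (simp add: sum.remove[of _ 0] sum.remove[of _ "Suc j"])
    also have "(\<Sum>i\<in>{..<m} - {0} - {Suc j}. y j i) \<le> (\<Sum>i\<in>{..<m} - {0} - {Suc j}. 1 / (4 * m))"
      using y_other j by (intro sum_mono) auto
    also have "\<dots> \<le> (\<Sum>i<m. 1 / (4 * m))"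
      by (intro sum_mono2) auto
    also have "\<dots> = 1 / 4"
      using m by simp
    finally show ?thesis
      using y_next[OF j] by linarith
  qed
  \<comment> \<open>Machine 0 thus carries load at least \<open>(m - 1) / 2\<close>, which exceeds
    \<open>m / 4\<close> because \<open>3 \<le> m\<close>.\<close>
  then have "(\<Sum>j<m - 1. 1 / 2) \<le> (\<Sum>j<m - 1. js ! j ! 0 * y j 0)"
    using m by (intro sum_mono) (auto simp: js_def nth_hard_jobs)
  also have "\<dots> \<le> m / 4"
    using load m by simp
  finally show False
    using m by simp
qed

theorem theorem40:
  fixes g :: "nat \<Rightarrow> real" and f :: "nat \<Rightarrow> nat \<Rightarrow> real \<Rightarrow> real"
  assumes "g \<in> o(\<lambda>m. real m)" and "polylog f"
  shows "\<not> (\<exists>A. umsc_competitive A g f) \<and>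
         \<not> (\<exists>A. umsc_frac_competitive A g f) \<and>
         \<not> (\<exists>A. ccfl_competitive A g f) \<and>
         \<not> (\<exists>A. ccfl_frac_competitive A g f)"
  \<comment> \<open>All claims reduce to fractional scheduling; integral facility location does so
    in two steps, through integral scheduling.\<close>
  using not_umsc_frac_competitive[OF assms] umsc_frac_competitive_int_to_frac
    umsc_competitive_umsc_alg_of_ccfl umsc_frac_competitive_umsc_alg_of_ccfl
  by meson

end
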